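(* Let $n\ge 1$ and let $A^1,\ldots,A^n$ be finite simple graphs containing no isolated vertices. Then \[ \prod_{i=1}^{n}\gamma_{pr}(A^i) \le 2^{n-1}(2n-1)\,\gamma_{pr}(A^1\Box\cdots\Box A^n). \]
   Context: All graphs are finite, simple and undirected. For a graph $G$ and vertex $v$, $N_G[v]$ denotes the closed neighborhood of $v$. A dominating set of $G$ is a set $D\subseteq V(G)$ with $N_G[v]\cap D\neq\emptyset$ for all $v$. A paired dominating set is a dominating set $D$ such that the induced subgraph $G[D]$ has a perfect matching; $\gamma_{pr}(G)$ is the minimum size of a paired dominating set. The Cartesian product $A^1\Box\cdots\Box A^n$ has vertex set $V(A^1)\times\cdots\times V(A^n)$, with $u^1\cdots u^n$ and $v^1\cdots v^n$ adjacent iff for some index $i$, $u^iv^i\in E(A^i)$ and $u^j=v^j$ for all $j\neq i$. *)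

theory Defs
  imports "Graph_Theory.Graph_Theory" "HOL-Library.FuncSet"
begin

text \<open>
  A finite simple undirected graph is a symmetric loop-free finite digraph, i.e. an element
  of \<^locale>\<open>graph\<close> or \<^locale>\<open>pair_graph\<close>; an edge \<open>uv\<close> is the pair of arcs
  \<open>(u,v)\<close>, \<open>(v,u)\<close>. The notions below are meant for such graphs. As in those locales, the
  null graph is not excluded.
\<close>

definition isolated_vertex :: "('a, 'b) pre_digraph \<Rightarrow> 'a \<Rightarrow> bool" where
  "isolated_vertex G v \<longleftrightarrow> v \<in> verts G \<and> \<not> (\<exists>u. v \<rightarrow>\<^bsub>G\<^esub> u)"

definition closed_neighborhood :: "('a, 'b) pre_digraph \<Rightarrow> 'a \<Rightarrow> 'a set" where
  "closed_neighborhood G v = insert v {u. v \<rightarrow>\<^bsub>G\<^esub> u}"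

definition undirected_edges :: "('a, 'b) pre_digraph \<Rightarrow> 'a set set" where
  "undirected_edges G = {{u, v} |u v. u \<rightarrow>\<^bsub>G\<^esub> v}"

definition matching :: "('a, 'b) pre_digraph \<Rightarrow> 'a set set \<Rightarrow> bool" where
  "matching G M \<longleftrightarrow> M \<subseteq> undirected_edges G \<and> pairwise disjnt M"

definition perfect_matching :: "('a, 'b) pre_digraph \<Rightarrow> 'a set set \<Rightarrow> bool" where
  "perfect_matching G M \<longleftrightarrow> matching G M \<and> \<Union>M = verts G"

definition dominating_set :: "('a, 'b) pre_digraph \<Rightarrow> 'a set \<Rightarrow> bool" where
  "dominating_set G D \<longleftrightarrow>
     D \<subseteq> verts G \<and> (\<forall>v\<in>verts G. closed_neighborhood G v \<inter> D \<noteq> {})"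

definition paired_dominating_set :: "('a, 'b) pre_digraph \<Rightarrow> 'a set \<Rightarrow> bool" where
  "paired_dominating_set G D \<longleftrightarrow> dominating_set G D \<and> (\<exists>M. perfect_matching (G \<restriction> D) M)"

text \<open>
  The minimum is over a nonempty set exactly when \<open>G\<close> has a paired dominating set, which holds
  for every graph without isolated vertices (lemma \<open>paired_domination_number_attained\<close> below).
\<close>

definition paired_domination_number :: "('a, 'b) pre_digraph \<Rightarrow> nat" where
  "paired_domination_number G = (LEAST k. \<exists>D. paired_dominating_set G D \<and> card D = k)"

text \<open>The vertices of the product are the tuples indexed by \<open>I\<close>, extensional outside \<open>I\<close>.\<close>

definition cartesian_product ::
  "'i set \<Rightarrow> ('i \<Rightarrow> 'a pair_pre_digraph) \<Rightarrow> ('i \<Rightarrow> 'a) pair_pre_digraph" where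
  "cartesian_product I A =
     \<lparr>pverts = (\<Pi>\<^sub>E i\<in>I. pverts (A i)),
      parcs = {(u, v). u \<in> (\<Pi>\<^sub>E i\<in>I. pverts (A i)) \<and> v \<in> (\<Pi>\<^sub>E i\<in>I. pverts (A i)) \<and>
                 (\<exists>i\<in>I. (u i, v i) \<in> parcs (A i) \<and> (\<forall>j\<in>I - {i}. u j = v j))}\<rparr>"

lemma pair_graph_cartesian_product:
  assumes "finite I" and A: "\<And>i. i \<in> I \<Longrightarrow> pair_graph (A i)"
  shows "pair_graph (cartesian_product I A)"
proof -
  let ?V = "\<Pi>\<^sub>E i\<in>I. pverts (A i)"
  have fin: "finite ?V"
    using assms by (intro finite_PiE) (auto intro: pair_fin_digraph.pair_finite_verts
        simp: pair_graph_def pair_digraph_def)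
  have "parcs (cartesian_product I A) \<subseteq> ?V \<times> ?V"
    by (auto simp: cartesian_product_def)
  then have fina: "finite (parcs (cartesian_product I A))"
    using fin by (meson finite_SigmaI finite_subset)
  have "sym (parcs (cartesian_product I A))"
  proof (rule symI)
    fix u v assume "(u, v) \<in> parcs (cartesian_product I A)"
    then obtain i where i: "u \<in> ?V" "v \<in> ?V" "i \<in> I" "(u i, v i) \<in> parcs (A i)"
      "\<forall>j\<in>I - {i}. u j = v j"
      by (auto simp: cartesian_product_def)
    interpret pair_graph "A i" using A i(3) .
    show "(v, u) \<in> parcs (cartesian_product I A)"
      unfolding cartesian_product_def using i(1,2,3) arcs_symmetric[OF i(4)] i(5)[THEN bspec, THEN sym]
      by simp blast
  qed
  moreover have "fst e \<noteq> snd e" if e: "e \<in> parcs (cartesian_product I A)" for e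
  proof -
    obtain i where i: "i \<in> I" "(fst e i, snd e i) \<in> parcs (A i)"
      using e by (auto simp: cartesian_product_def)
    interpret pair_graph "A i" using A i(1) .
    show ?thesis using no_loops'[OF i(2)] by auto
  qed
  ultimately show ?thesis
    using fin fina by unfold_locales (auto simp: cartesian_product_def symmetric_def)
qed

lemma no_isolated_vertex_cartesian_product:
  assumes "I \<noteq> {}" and A: "\<And>i. i \<in> I \<Longrightarrow> pair_graph (A i)"
    and ni: "\<And>i. i \<in> I \<Longrightarrow> \<nexists>v. isolated_vertex (A i) v"
  shows "\<nexists>v. isolated_vertex (cartesian_product I A) v"
proof
  assume "\<exists>v. isolated_vertex (cartesian_product I A) v"
  then obtain v where v: "v \<in> (\<Pi>\<^sub>E i\<in>I. pverts (A i))"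
      and iso: "\<And>u. (v, u) \<notin> parcs (cartesian_product I A)"
    by (auto simp: isolated_vertex_def cartesian_product_def)
  obtain i where i: "i \<in> I" using assms(1) by blast
  then have "v i \<in> pverts (A i)" using v by auto
  then obtain x where x: "(v i, x) \<in> parcs (A i)"
    using ni[OF i] by (auto simp: isolated_vertex_def)
  interpret pair_graph "A i" using A i .
  have "(v, v(i := x)) \<in> parcs (cartesian_product I A)"
    using v i x in_arcsD2[OF x] by (auto simp: cartesian_product_def PiE_def extensional_def Pi_def)
  then show False using iso by blast
qed

lemma paired_dominating_set_exists:
  assumes "graph G" and ni: "\<nexists>v. isolated_vertex G v"
  shows "\<exists>D. paired_dominating_set G D"
proof -
  interpret graph G by fact
  have edge_verts: "\<Union>(undirected_edges G) \<subseteq> verts G"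
    by (auto simp: undirected_edges_def)
  then have finE: "finite (undirected_edges G)"
    by (meson finite_UnionD finite_subset finite_verts)
  have "finite {M. matching G M}"
    by (rule finite_subset[of _ "Pow (undirected_edges G)"]) (use finE in \<open>auto simp: matching_def\<close>)
  moreover have "matching G {}" by (simp add: matching_def)
  ultimately obtain M where M: "matching G M" and
      maximal: "\<And>M'. matching G M' \<Longrightarrow> M \<subseteq> M' \<Longrightarrow> M' = M"
    using finite_has_maximal[of "{M. matching G M}"] by (metis empty_iff mem_Collect_eq)
  let ?D = "\<Union>M"
  have sub: "?D \<subseteq> verts G" using M edge_verts by (auto simp: matching_def)
  have "closed_neighborhood G v \<inter> ?D \<noteq> {}" if v: "v \<in> verts G" for v
  proof
    assume none: "closed_neighborhood G v \<inter> ?D = {}"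
    obtain u where u: "v \<rightarrow>\<^bsub>G\<^esub> u" using ni v by (auto simp: isolated_vertex_def)
    have "u \<notin> ?D" "v \<notin> ?D" using none u by (auto simp: closed_neighborhood_def)
    then have "matching G (insert {v, u} M)"
      using M u by (auto simp: matching_def undirected_edges_def pairwise_insert disjnt_def)
    then have "{v, u} \<in> M" using maximal by blast
    then show False using \<open>v \<notin> ?D\<close> by blast
  qed
  moreover have "perfect_matching (G \<restriction> ?D) M"
  proof -
    have "e \<in> undirected_edges (G \<restriction> ?D)" if e: "e \<in> M" for e
    proof -
      obtain u v where uv: "e = {u, v}" "u \<rightarrow>\<^bsub>G\<^esub> v"
        using M e by (auto simp: matching_def undirected_edges_def)
      have "u \<in> ?D" "v \<in> ?D" using e uv(1) by blast+
      then have "u \<rightarrow>\<^bsub>G \<restriction> ?D\<^esub> v" using uv(2) by (fastforce simp: arcs_ends_conv)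
      then show ?thesis using uv(1) by (auto simp: undirected_edges_def)
    qed
    then show ?thesis using M by (auto simp: perfect_matching_def matching_def)
  qed
  ultimately show ?thesis
    using sub by (auto simp: paired_dominating_set_def dominating_set_def)
qed

lemma paired_domination_number_attained:
  assumes "graph G" and "\<nexists>v. isolated_vertex G v"
  shows "\<exists>D. paired_dominating_set G D \<and> card D = paired_domination_number G"
  unfolding paired_domination_number_def
  by (rule LeastI_ex) (use paired_dominating_set_exists[OF assms] in blast)

end

theory Submission
  imports Defs
begin

text \<open>
  Each factor \<open>A\<^sup>i\<close> has a minimum paired dominating set with perfect matching \<open>P i\<close>; sending every
  vertex to a matching edge that dominates it partitions \<open>V(A\<^sup>i)\<close> into blocks indexed by \<open>P i\<close>, and
  the product into cells indexed by \<open>\<Pi> P i\<close>. Let \<open>D\<close> be a paired dominating set of the product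
  with perfect matching \<open>M\<close>. As in the argument of Clark and Suen, each cell has a direction \<open>i\<close>
  such that its \<open>i\<close>-th block is dominated by the \<open>i\<close>-th coordinates of those \<open>d \<in> D\<close> that agree with
  the cell in all other directions: otherwise failing coordinates in all directions would combine to
  a vertex not dominated by \<open>D\<close>.

  Within one line of cells in direction \<open>i\<close>, replacing the edges of \<open>P i\<close> that belong to such cells
  by the projected edges of \<open>M\<close> in direction \<open>i\<close>, and by one edge for each remaining
  vertex of \<open>D\<close> near that line, again dominates \<open>A\<^sup>i\<close>, so by minimality of \<open>P i\<close> the new edges are
  at least as many. With \<open>M i \<subseteq> M\<close> the edges in direction \<open>i\<close>, summing over all lines
  bounds the number of cells by \<open>\<Sum>i. |M i| + 2 (|M| - |M i|) \<le> (2 n - 1) |M|\<close>.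
\<close>

section \<open>Edges and matchings of a single graph\<close>

lemma graph_with_proj:
  assumes "pair_graph G" shows "graph (with_proj G)"
proof -
  interpret pair_graph G by fact
  show ?thesis by unfold_locales
qed

lemma (in graph) undirected_edge_verts: "e \<in> undirected_edges G \<Longrightarrow> e \<subseteq> verts G"
  by (auto simp: undirected_edges_def)

lemma (in graph) finite_undirected_edges: "finite (undirected_edges G)"
  by (rule finite_subset[of _ "Pow (verts G)"]) (auto dest: undirected_edge_verts)

lemma (in graph) card_undirected_edge:
  assumes "e \<in> undirected_edges G" shows "card e = 2"
proof -
  obtain u v where e: "e = {u, v}" "u \<rightarrow>\<^bsub>G\<^esub> v"
    using assms by (auto simp: undirected_edges_def)
  then have "u \<noteq> v" using adj_not_same by blast
  then show ?thesis using e by simp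
qed

lemma (in graph) finite_matching: "matching G M \<Longrightarrow> finite M"
  using finite_undirected_edges finite_subset by (auto simp: matching_def)

lemma (in graph) card_Union_matching:
  assumes "matching G M" shows "card (\<Union>M) = 2 * card M"
proof -
  have M: "M \<subseteq> undirected_edges G" "pairwise disjnt M"
    using assms by (auto simp: matching_def)
  have "finite e" if "e \<in> M" for e
    using card_undirected_edge[of e] M(1) that card.infinite[of e] by fastforce
  then have "card (\<Union>M) = (\<Sum>e\<in>M. card e)"
    by (intro card_Union_disjoint) (use M in \<open>auto simp: pairwise_def disjnt_def\<close>)
  also have "\<dots> = (\<Sum>e\<in>M. 2)"
    using M by (intro sum.cong) (auto intro: card_undirected_edge)
  finally show ?thesis by simp
qed

text \<open>An edge of \<open>M\<close> has both ends in \<open>\<Union>M\<close>, so it survives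
  the restriction to that set. From here on matchings live in \<open>G\<close> itself.\<close>

lemma perfect_matching_induce_subgraph_iff:
  "perfect_matching (G \<restriction> D) M \<longleftrightarrow> matching G M \<and> \<Union>M = D"
proof
  assume "perfect_matching (G \<restriction> D) M"
  moreover have "undirected_edges (G \<restriction> D) \<subseteq> undirected_edges G"
    by (auto simp: undirected_edges_def arcs_ends_conv)
  ultimately show "matching G M \<and> \<Union>M = D"
    by (auto simp: perfect_matching_def matching_def)
next
  assume M: "matching G M \<and> \<Union>M = D"
  have "e \<in> undirected_edges (G \<restriction> D)" if e: "e \<in> M" for e
  proof -
    obtain u v where uv: "e = {u, v}" "u \<rightarrow>\<^bsub>G\<^esub> v"
      using M e by (auto simp: matching_def undirected_edges_def)
    have "u \<in> D" "v \<in> D" using M e uv(1) by blast+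
    then have "u \<rightarrow>\<^bsub>G \<restriction> D\<^esub> v" using uv(2) by (fastforce simp: arcs_ends_conv)
    then show ?thesis using uv(1) by (auto simp: undirected_edges_def)
  qed
  then show "perfect_matching (G \<restriction> D) M"
    using M by (auto simp: perfect_matching_def matching_def)
qed

lemma paired_dominating_set_iff:
  "paired_dominating_set G D \<longleftrightarrow> dominating_set G D \<and> (\<exists>M. matching G M \<and> \<Union>M = D)"
  by (simp add: paired_dominating_set_def perfect_matching_induce_subgraph_iff)

section \<open>Dominating edge sets and the exchange argument\<close>

text \<open>
  The edges are processed one by one. If an edge meets \<open>\<Union>M\<close> in one end only, match its other end
  \<open>v\<close> with a neighbour outside \<open>\<Union>M\<close>; if there is none, everything dominated by \<open>v\<close> is
  already dominated by \<open>\<Union>M\<close>.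
\<close>

lemma (in graph) matching_dominating_edges:
  assumes "finite E" "E \<subseteq> undirected_edges G"
  shows "\<exists>M. matching G M \<and> card M \<le> card E \<and>
           (\<forall>v. closed_neighborhood G v \<inter> \<Union>E \<noteq> {} \<longrightarrow> closed_neighborhood G v \<inter> \<Union>M \<noteq> {})"
  using assms
proof (induction E rule: finite_induct)
  case empty
  have "matching G {}" by (simp add: matching_def)
  then show ?case by (intro exI[of _ "{}"]) simp
next
  case (insert e E)
  then obtain M where M: "matching G M" "card M \<le> card E"
    and dom: "\<And>v. closed_neighborhood G v \<inter> \<Union>E \<noteq> {} \<Longrightarrow> closed_neighborhood G v \<inter> \<Union>M \<noteq> {}"
    by auto
  have card: "card E + 1 = card (insert e E)" using insert by simp
  \<comment> \<open>\<open>extend\<close> spends the allowance for \<open>e\<close> on an edge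
    disjoint from \<open>M\<close>, \<open>keep\<close> spends nothing; every position of
    \<open>e\<close> relative to \<open>\<Union>M\<close> reduces to one of the two.\<close>
  have extend: ?case
    if f: "f \<in> undirected_edges G" "f \<inter> \<Union>M = {}"
      and e: "\<And>v. closed_neighborhood G v \<inter> e \<noteq> {} \<Longrightarrow>
            closed_neighborhood G v \<inter> (f \<union> \<Union>M) \<noteq> {}" for f
  proof (intro exI[of _ "insert f M"] conjI allI impI)
    show "matching G (insert f M)"
      using M f by (auto simp: matching_def pairwise_insert disjnt_def)
    show "card (insert f M) \<le> card (insert e E)"
      using M card finite_matching[OF M(1)] by (simp add: card_insert_if)
    fix v assume "closed_neighborhood G v \<inter> \<Union>(insert e E) \<noteq> {}"
    then show "closed_neighborhood G v \<inter> \<Union>(insert f M) \<noteq> {}"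
      using dom[of v] e[of v] by auto
  qed
  have keep: ?case
    if e: "\<And>v. closed_neighborhood G v \<inter> e \<noteq> {} \<Longrightarrow> closed_neighborhood G v \<inter> \<Union>M \<noteq> {}"
  proof (intro exI[of _ M] conjI allI impI)
    show "card M \<le> card (insert e E)" using M card by simp
    fix v assume "closed_neighborhood G v \<inter> \<Union>(insert e E) \<noteq> {}"
    then show "closed_neighborhood G v \<inter> \<Union>M \<noteq> {}"
      using dom[of v] e[of v] by auto
  qed (fact M)
  have half: ?case if e: "e = {u, v}" and adj: "u \<rightarrow>\<^bsub>G\<^esub> v" and u: "u \<in> \<Union>M" and v: "v \<notin> \<Union>M" for u v
  proof (cases "\<exists>w. v \<rightarrow>\<^bsub>G\<^esub> w \<and> w \<notin> \<Union>M")
    case True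
    then obtain w where w: "v \<rightarrow>\<^bsub>G\<^esub> w" "w \<notin> \<Union>M" by blast
    show ?thesis
    proof (rule extend[of "{v, w}"])
      show "{v, w} \<in> undirected_edges G" using w by (auto simp: undirected_edges_def)
      show "{v, w} \<inter> \<Union>M = {}" using v w by blast
    qed (use e u in blast)
  next
    case False
    show ?thesis
    proof (rule keep)
      fix x assume "closed_neighborhood G x \<inter> e \<noteq> {}"
      then consider "u \<in> closed_neighborhood G x" | "x = v" | "x \<rightarrow>\<^bsub>G\<^esub> v"
        using e by (auto simp: closed_neighborhood_def)
      then show "closed_neighborhood G x \<inter> \<Union>M \<noteq> {}"
      proof cases
        case 1 then show ?thesis using u by blast
      next
        case 2
        then have "u \<in> closed_neighborhood G x"
          using graph_symmetric[OF adj] by (simp add: closed_neighborhood_def)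
        then show ?thesis using u by blast
      next
        case 3
        then have "x \<in> \<Union>M" using False graph_symmetric by blast
        then show ?thesis by (auto simp: closed_neighborhood_def)
      qed
    qed
  qed
  have "e \<in> undirected_edges G" using insert by simp
  then obtain u v where e: "e = {u, v}" and adj: "u \<rightarrow>\<^bsub>G\<^esub> v" by (auto simp: undirected_edges_def)
  consider "u \<in> \<Union>M" "v \<in> \<Union>M" | "u \<in> \<Union>M" "v \<notin> \<Union>M" | "u \<notin> \<Union>M" "v \<in> \<Union>M"
    | "u \<notin> \<Union>M" "v \<notin> \<Union>M" by blast
  then show ?case
  proof cases
    case 1 then show ?thesis by (intro keep) (use e in blast)
  next
    case 2 then show ?thesis using half[OF e adj] by blast
  next
    case 3
    have "e = {v, u}" using e by blast
    then show ?thesis using half[of v u] 3 graph_symmetric[OF adj] by blast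
  next
    case 4 then show ?thesis
      by (intro extend[of e]) (use e \<open>e \<in> undirected_edges G\<close> in blast)+
  qed
qed

text \<open>The edges may overlap, so replacement edges can be chosen freely; they are made disjoint
  only here, at no cost in number or domination.\<close>

lemma (in graph) paired_domination_number_le_edges:
  assumes "E \<subseteq> undirected_edges G" "dominating_set G (\<Union>E)"
  shows "paired_domination_number G \<le> 2 * card E"
proof -
  have "finite E" using assms(1) finite_undirected_edges finite_subset by blast
  then obtain M where M: "matching G M" "card M \<le> card E"
    and dom: "\<And>v. closed_neighborhood G v \<inter> \<Union>E \<noteq> {} \<Longrightarrow> closed_neighborhood G v \<inter> \<Union>M \<noteq> {}"
    using matching_dominating_edges assms(1) by metis
  have "\<Union>M \<subseteq> verts G" using M(1) undirected_edge_verts by (auto simp: matching_def)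
  then have "paired_dominating_set G (\<Union>M)"
    using assms(2) dom M(1) by (auto simp: paired_dominating_set_iff dominating_set_def)
  then have "paired_domination_number G \<le> card (\<Union>M)"
    unfolding paired_domination_number_def by (intro Least_le) blast
  then show ?thesis using M card_Union_matching by simp
qed

lemma minimum_paired_dominating_matching:
  assumes "graph G" "\<nexists>v. isolated_vertex G v"
  obtains M where "matching G M" "dominating_set G (\<Union>M)" "paired_domination_number G = 2 * card M"
proof -
  interpret graph G by fact
  obtain D where D: "paired_dominating_set G D" "card D = paired_domination_number G"
    using paired_domination_number_attained[OF assms] by blast
  then obtain M where "matching G M" "\<Union>M = D" by (auto simp: paired_dominating_set_iff)
  then show thesis using that D card_Union_matching by (metis paired_dominating_set_iff)
qed

text \<open>Exchange: trade \<open>S\<close> for \<open>E\<close> and one edge at each vertex of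
  \<open>W\<close>. A vertex whose block is outside \<open>S\<close> keeps its edge
  \<open>f v\<close>, and \<open>dom\<close> covers the others, so minimality of \<open>P\<close>
  forbids a gain.\<close>

lemma (in graph) card_replaced_edges_le:
  assumes ni: "\<nexists>v. isolated_vertex G v"
    and P: "P \<subseteq> undirected_edges G" "paired_domination_number G = 2 * card P"
    and f: "\<And>v. v \<in> verts G \<Longrightarrow> f v \<in> P \<and> closed_neighborhood G v \<inter> f v \<noteq> {}"
    and S: "S \<subseteq> P" and E: "E \<subseteq> undirected_edges G" and W: "W \<subseteq> verts G"
    and dom: "\<And>v. v \<in> verts G \<Longrightarrow> f v \<in> S \<Longrightarrow> closed_neighborhood G v \<inter> (\<Union>E \<union> W) \<noteq> {}"
  shows "card S \<le> card E + card W"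
proof -
  have "\<exists>e\<in>undirected_edges G. w \<in> e" if w: "w \<in> W" for w
  proof -
    obtain u where "w \<rightarrow>\<^bsub>G\<^esub> u" using ni W w by (auto simp: isolated_vertex_def)
    then have "{w, u} \<in> undirected_edges G" by (auto simp: undirected_edges_def)
    then show ?thesis by blast
  qed
  then obtain g where g: "\<And>w. w \<in> W \<Longrightarrow> g w \<in> undirected_edges G \<and> w \<in> g w" by metis
  define F where "F = (P - S) \<union> E \<union> g ` W"
  have fin: "finite P" "finite S" "finite W"
    using P(1) S W finite_undirected_edges finite_verts finite_subset by metis+
  have F: "F \<subseteq> undirected_edges G" using P E g by (auto simp: F_def)
  have "closed_neighborhood G v \<inter> \<Union>F \<noteq> {}" if v: "v \<in> verts G" for v
  proof (cases "f v \<in> S")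
    case True
    have "\<Union>E \<union> W \<subseteq> \<Union>F" using g by (auto simp: F_def)
    then show ?thesis using dom[OF v True] by blast
  next
    case False
    then have "f v \<subseteq> \<Union>F" using f[OF v] by (auto simp: F_def)
    then show ?thesis using f[OF v] by blast
  qed
  then have "dominating_set G (\<Union>F)"
    using F undirected_edge_verts by (fastforce simp: dominating_set_def)
  then have "card P \<le> card F"
    using paired_domination_number_le_edges[OF F] P(2) by simp
  also have "\<dots> \<le> card (P - S) + card E + card (g ` W)"
    unfolding F_def by (meson add_le_mono1 card_Un_le le_trans)
  also have "\<dots> \<le> card P - card S + card E + card W"
    using card_image_le[OF fin(3)] card_Diff_subset[OF fin(2) S] by (simp add: add_mono)
  finally show ?thesis using card_mono[OF fin(1) S] by linarith
qed

section \<open>Counting the cells of the product\<close>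

lemma sum_card_fibres_le:
  assumes "finite X" "finite T" "\<And>x k k'. R x k \<Longrightarrow> R x k' \<Longrightarrow> k = k'"
  shows "(\<Sum>k\<in>T. card {x \<in> X. R x k}) \<le> card X"
proof -
  have "(\<Sum>k\<in>T. card {x \<in> X. R x k}) = card (\<Union>k\<in>T. {x \<in> X. R x k})"
    by (rule card_UN_disjoint[symmetric]) (use assms in auto)
  also have "\<dots> \<le> card X" using assms by (intro card_mono) auto
  finally show ?thesis .
qed

lemma prod_card_cells_le:
  fixes I :: "'i set" and A :: "'i \<Rightarrow> 'a pair_pre_digraph"
  assumes I: "finite I"
    and A: "\<And>i. i \<in> I \<Longrightarrow> pair_graph (A i)"
    and ni: "\<And>i. i \<in> I \<Longrightarrow> \<nexists>v. isolated_vertex (A i) v"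
    and P: "\<And>i. i \<in> I \<Longrightarrow> matching (A i) (P i)" "\<And>i. i \<in> I \<Longrightarrow> dominating_set (A i) (\<Union>(P i))"
      "\<And>i. i \<in> I \<Longrightarrow> paired_domination_number (A i) = 2 * card (P i)"
    and M: "matching (cartesian_product I A) M" "dominating_set (cartesian_product I A) (\<Union>M)"
  shows "(\<Prod>i\<in>I. card (P i)) \<le> (2 * card I - 1) * card M"
proof -
  let ?C = "cartesian_product I A"
  let ?D = "\<Union>M"
  have graph: "graph (with_proj (A i))" if "i \<in> I" for i
    using graph_with_proj[OF A[OF that]] .
  interpret C: pair_graph ?C by (rule pair_graph_cartesian_product) (use I A in auto)
  have finM: "finite M" using C.finite_matching M(1) by simp
  have finP: "finite (P i)" if "i \<in> I" for i
    using graph.finite_matching[OF graph P(1)] that by blast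
  have D: "?D \<subseteq> (\<Pi>\<^sub>E i\<in>I. pverts (A i))"
    using M(2) by (simp add: dominating_set_def) (simp add: cartesian_product_def)
  have finD: "finite ?D"
    using M(2) finite_subset[OF _ C.finite_verts] by (simp add: dominating_set_def)

  have "\<exists>e\<in>P i. closed_neighborhood (A i) v \<inter> e \<noteq> {}" if "i \<in> I" "v \<in> pverts (A i)" for i v
    using P(2)[OF that(1)] that(2) by (fastforce simp: dominating_set_def)
  then obtain f where f: "\<And>i v. i \<in> I \<Longrightarrow> v \<in> pverts (A i) \<Longrightarrow>
      f i v \<in> P i \<and> closed_neighborhood (A i) v \<inter> f i v \<noteq> {}"
    by metis

  \<comment> \<open>\<open>\<phi> i d\<close> names the line of cells in direction \<open>i\<close>
    through \<open>d\<close>, and \<open>T i\<close> is the set of all such lines.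
    \<open>S i K\<close> holds the blocks dominated from within the line \<open>K\<close>.\<close>
  define \<phi> where "\<phi> i d = restrict (\<lambda>l. f l (d l)) (I - {i})" for i d
  define S where "S i K = {e \<in> P i. \<forall>x\<in>pverts (A i). f i x = e \<longrightarrow>
      (\<exists>d\<in>?D. \<phi> i d = K \<and> d i \<in> closed_neighborhood (A i) x)}" for i K
  define along where "along i m \<longleftrightarrow>
      (\<exists>u v. m = {u, v} \<and> (u i, v i) \<in> parcs (A i) \<and> (\<forall>l\<in>I - {i}. u l = v l))" for i m
  define N where "N i = {m \<in> M. along i m}" for i
  define T where "T i = (\<Pi>\<^sub>E l\<in>I - {i}. P l)" for i
  have finT: "finite (T i)" for i
    unfolding T_def using I finP by (intro finite_PiE) auto

  have M_N: "M \<subseteq> (\<Union>i\<in>I. N i)"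
  proof
    fix m assume m: "m \<in> M"
    then obtain u v where "m = {u, v}" "(u, v) \<in> parcs ?C"
      using M(1) by (auto simp: matching_def undirected_edges_def)
    then show "m \<in> (\<Union>i\<in>I. N i)"
      using m by (auto simp: N_def along_def cartesian_product_def)
  qed

  have cell: "\<exists>i\<in>I. J i \<in> S i (restrict J (I - {i}))" if J: "J \<in> (\<Pi>\<^sub>E i\<in>I. P i)" for J
  proof (rule ccontr)
    assume neg: "\<not> ?thesis"
    have "\<exists>x\<in>pverts (A i). f i x = J i \<and> (\<forall>d\<in>?D. \<phi> i d = restrict J (I - {i}) \<longrightarrow>
        d i \<notin> closed_neighborhood (A i) x)" if "i \<in> I" for i
      using neg that J by (auto simp: S_def)
    then obtain x where x: "\<And>i. i \<in> I \<Longrightarrow> x i \<in> pverts (A i)" "\<And>i. i \<in> I \<Longrightarrow> f i (x i) = J i"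
      and bad: "\<And>i d. i \<in> I \<Longrightarrow> d \<in> ?D \<Longrightarrow> \<phi> i d = restrict J (I - {i}) \<Longrightarrow>
        d i \<notin> closed_neighborhood (A i) (x i)"
      by metis
    have xV: "restrict x I \<in> pverts ?C" using x by (simp add: cartesian_product_def)
    then obtain d where d: "d \<in> ?D" "d \<in> closed_neighborhood ?C (restrict x I)"
      using M(2) unfolding dominating_set_def by (metis disjoint_iff with_proj_simps(1))
    \<comment> \<open>If \<open>d\<close> is the vertex itself, any direction serves, so one must
      exist: \<open>d\<close> is an end of an edge of \<open>M\<close>, and that edge has a
      direction.\<close>
    have "I \<noteq> {}"
      using M_N d(1) by blast
    then obtain i where i: "i \<in> I" "d i \<in> closed_neighborhood (A i) (x i)" "\<forall>l\<in>I - {i}. x l = d l"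
      using d(2) by (auto simp: closed_neighborhood_def cartesian_product_def)
    \<comment> \<open>Off \<open>i\<close>, \<open>d\<close> agrees with \<open>x\<close>, whose
      coordinates were chosen in the blocks of \<open>J\<close>.\<close>
    have "\<phi> i d = restrict J (I - {i})"
      unfolding \<phi>_def by (rule restrict_ext) (use i(3) x(2) in fastforce)
    then show False using bad[OF i(1) d(1)] i(2) by blast
  qed

  have line: "card (S i K) \<le> card {m \<in> N i. \<phi> i ` m = {K}} + card {d \<in> ?D - \<Union>(N i). \<phi> i d = K}"
    if i: "i \<in> I" for i K
  proof -
    let ?E = "(\<lambda>m. (\<lambda>u. u i) ` m) ` {m \<in> N i. \<phi> i ` m = {K}}"
    let ?W = "(\<lambda>u. u i) ` {d \<in> ?D - \<Union>(N i). \<phi> i d = K}"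
    interpret G: graph "with_proj (A i)" using graph[OF i] .
    have "card (S i K) \<le> card ?E + card ?W"
    proof (rule G.card_replaced_edges_le[where f = "f i" and P = "P i"])
      show "P i \<subseteq> undirected_edges (A i)" using P(1)[OF i] by (simp add: matching_def)
      show "?E \<subseteq> undirected_edges (A i)"
        by (fastforce simp: N_def along_def undirected_edges_def)
      show "?W \<subseteq> verts (A i)" using D i by fastforce
      fix x assume x: "x \<in> verts (A i)" "f i x \<in> S i K"
      then obtain d where d: "d \<in> ?D" "\<phi> i d = K" "d i \<in> closed_neighborhood (A i) x"
        unfolding S_def by (simp del: Union_iff) blast
      have "d i \<in> \<Union>?E \<union> ?W"
      proof (cases "d \<in> \<Union>(N i)")
        case True
        then obtain m where m: "m \<in> N i" "d \<in> m" by blast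
        then obtain u v where uv: "m = {u, v}" "\<forall>l\<in>I - {i}. u l = v l"
          by (auto simp: N_def along_def)
        \<comment> \<open>Both ends of an edge in direction \<open>i\<close> lie on one line, so one
          projected edge accounts for both.\<close>
        then have "\<phi> i u = \<phi> i v" unfolding \<phi>_def by (intro restrict_ext) simp
        then have "\<phi> i ` m = {K}" using uv(1) m(2) d(2) by auto
        then show ?thesis using m by blast
      next
        case False
        then show ?thesis using d by blast
      qed
      then show "closed_neighborhood (A i) x \<inter> (\<Union>?E \<union> ?W) \<noteq> {}" using d(3) by blast
    qed (use ni[OF i] P(3)[OF i] f[OF i] in \<open>auto simp: S_def\<close>)
    also have "card ?E \<le> card {m \<in> N i. \<phi> i ` m = {K}}"
      by (rule card_image_le) (use finM in \<open>simp add: N_def\<close>)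
    also have "card ?W \<le> card {d \<in> ?D - \<Union>(N i). \<phi> i d = K}"
      by (intro card_image_le finite_subset[OF _ finD]) blast
    finally show ?thesis by simp
  qed

  \<comment> \<open>An edge in direction \<open>i\<close> is charged once, any other edge of
    \<open>M\<close> once per end. Each edge or vertex is charged to at most one line. Adding
    \<open>card (N i)\<close> on the left avoids truncated subtraction.\<close>
  have direction: "(\<Sum>K\<in>T i. card (S i K)) + card (N i) \<le> 2 * card M" if i: "i \<in> I" for i
  proof -
    have N: "N i \<subseteq> M" by (auto simp: N_def)
    then have "matching ?C (N i)" using M(1) by (auto simp: matching_def intro: pairwise_subset)
    then have cN: "card (\<Union>(N i)) = 2 * card (N i)" by (rule C.card_Union_matching)
    have sub: "\<Union>(N i) \<subseteq> ?D" using N by blast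
    have "(\<Sum>K\<in>T i. card (S i K)) \<le> (\<Sum>K\<in>T i. card {m \<in> N i. \<phi> i ` m = {K}}) +
        (\<Sum>K\<in>T i. card {d \<in> ?D - \<Union>(N i). \<phi> i d = K})"
      unfolding sum.distrib[symmetric] by (intro sum_mono line i)
    also have "\<dots> \<le> card (N i) + card (?D - \<Union>(N i))"
      by (intro add_mono sum_card_fibres_le finT finite_Diff finD finite_subset[OF N finM]) auto
    also have "card (?D - \<Union>(N i)) = 2 * card M - 2 * card (N i)"
      using card_Diff_subset[OF finite_subset[OF sub finD] sub] cN C.card_Union_matching[OF M(1)]
      by simp
    finally show ?thesis using card_mono[OF finM N] by linarith
  qed

  \<comment> \<open>Every edge has a direction, so the savings \<open>card (N i)\<close> sum to at
    least \<open>card M\<close>; this turns \<open>2 * card I\<close> into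
    \<open>2 * card I - 1\<close>.\<close>
  have "card M \<le> card (\<Union>i\<in>I. N i)"
    by (intro card_mono M_N) (use I finM in \<open>auto simp: N_def\<close>)
  also have "\<dots> \<le> (\<Sum>i\<in>I. card (N i))" by (rule card_UN_le[OF I])
  finally have MN: "card M \<le> (\<Sum>i\<in>I. card (N i))" .

  \<comment> \<open>A cell is rebuilt from its line \<open>K\<close> by restoring coordinate
    \<open>i\<close>; by \<open>cell\<close>, the sets \<open>?B i\<close> cover all cells.\<close>
  let ?B = "\<lambda>i. \<Union>K\<in>T i. (\<lambda>e. K(i := e)) ` S i K"
  have finS: "finite (S i K)" if "i \<in> I" for i K using finP[OF that] by (simp add: S_def)
  have "(\<Pi>\<^sub>E i\<in>I. P i) \<subseteq> (\<Union>i\<in>I. ?B i)"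
  proof
    fix J assume J: "J \<in> (\<Pi>\<^sub>E i\<in>I. P i)"
    then obtain i where i: "i \<in> I" "J i \<in> S i (restrict J (I - {i}))" using cell by blast
    have "restrict J (I - {i}) \<in> T i" using J by (auto simp: T_def)
    moreover have "J = (restrict J (I - {i}))(i := J i)"
      using J by (auto simp: fun_eq_iff restrict_def PiE_def extensional_def)
    ultimately show "J \<in> (\<Union>i\<in>I. ?B i)" using i by blast
  qed
  then have "card (\<Pi>\<^sub>E i\<in>I. P i) \<le> card (\<Union>i\<in>I. ?B i)"
    by (intro card_mono) (use I finT finS in auto)
  also have "\<dots> \<le> (\<Sum>i\<in>I. card (?B i))" by (rule card_UN_le[OF I])
  also have "\<dots> \<le> (\<Sum>i\<in>I. \<Sum>K\<in>T i. card (S i K))"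
  proof (rule sum_mono)
    fix i assume i: "i \<in> I"
    have "card (?B i) \<le> (\<Sum>K\<in>T i. card ((\<lambda>e. K(i := e)) ` S i K))" by (rule card_UN_le[OF finT])
    also have "\<dots> \<le> (\<Sum>K\<in>T i. card (S i K))" by (intro sum_mono card_image_le finS i)
    finally show "card (?B i) \<le> (\<Sum>K\<in>T i. card (S i K))" .
  qed
  finally have "card (\<Pi>\<^sub>E i\<in>I. P i) + card M \<le> (\<Sum>i\<in>I. (\<Sum>K\<in>T i. card (S i K)) + card (N i))"
    using MN by (simp add: sum.distrib)
  also have "\<dots> \<le> (\<Sum>i\<in>I. 2 * card M)" by (intro sum_mono direction)
  finally have "card (\<Pi>\<^sub>E i\<in>I. P i) + card M \<le> 2 * card I * card M" by simp
  then show ?thesis using I by (simp add: card_PiE diff_mult_distrib)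
qed

theorem theorem5:
  fixes n :: nat and A :: "nat \<Rightarrow> 'a pair_pre_digraph"
  assumes "n \<ge> 1"
    and "\<And>i. i \<in> {1..n} \<Longrightarrow> pair_graph (A i)"
    and "\<And>i. i \<in> {1..n} \<Longrightarrow> \<not> (\<exists>v. isolated_vertex (A i) v)"
  shows "(\<Prod>i=1..n. paired_domination_number (A i))
           \<le> 2 ^ (n - 1) * (2 * n - 1) * paired_domination_number (cartesian_product {1..n} A)"
proof -
  let ?C = "cartesian_product {1..n} A"
  have "\<exists>P. matching (A i) P \<and> dominating_set (A i) (\<Union>P) \<and>
      paired_domination_number (A i) = 2 * card P" if "i \<in> {1..n}" for i
    using minimum_paired_dominating_matching[OF graph_with_proj[OF assms(2)[OF that]] assms(3)[OF that]]
    by blast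
  then obtain P where P: "\<And>i. i \<in> {1..n} \<Longrightarrow> matching (A i) (P i)"
      "\<And>i. i \<in> {1..n} \<Longrightarrow> dominating_set (A i) (\<Union>(P i))"
      "\<And>i. i \<in> {1..n} \<Longrightarrow> paired_domination_number (A i) = 2 * card (P i)"
    by metis
  have "pair_graph ?C" by (intro pair_graph_cartesian_product finite_atLeastAtMost assms(2))
  moreover have "\<nexists>v. isolated_vertex ?C v"
    by (intro no_isolated_vertex_cartesian_product assms(2,3)) (use assms(1) in auto)
  ultimately obtain M where M: "matching ?C M" "dominating_set ?C (\<Union>M)"
      "paired_domination_number ?C = 2 * card M"
    using minimum_paired_dominating_matching[OF graph_with_proj] by blast
  have "(\<Prod>i=1..n. paired_domination_number (A i)) = 2 ^ n * (\<Prod>i=1..n. card (P i))"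
    using P(3) by (simp add: prod.distrib)
  also have "\<dots> \<le> 2 ^ n * ((2 * n - 1) * card M)"
    using prod_card_cells_le[OF finite_atLeastAtMost assms(2,3) P M(1,2)] by simp
  \<comment> \<open>One of the \<open>n\<close> factors 2 turns \<open>card M\<close> into the
    paired domination number of the product.\<close>
  also have "\<dots> = 2 ^ (n - 1) * (2 * n - 1) * (2 * card M)"
    using assms(1) by (cases n) (auto simp: algebra_simps)
  finally show ?thesis using M(3) by simp
qed

end
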